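(* Let $\mathbb{T}$ be a time scale, let $\alpha,\beta\in\mathbb{T}$ with $\alpha<\beta$, let $\psi,\phi:[\alpha,\beta]_{\mathbb{T}}\to(0,\infty)$ be functions such that the Delta integrals below converge, and let $T:[\alpha,\beta]\to(0,\infty)$ be a differentiable and decreasing function on the real interval $[\alpha,\beta]$. If $\psi/\phi$ is increasing (respectively, decreasing) on $[\alpha,\beta]_{\mathbb{T}}$ and $\psi(\alpha)/\phi(\alpha)\ge 1$ (respectively, $\psi(\alpha)/\phi(\alpha)\le 1$), then the function $$s\mapsto\frac{T(s)+\int_\alpha^\beta \psi(\upsilon)s^\upsilon\,\Delta\upsilon}{T(s)+\int_\alpha^\beta \phi(\upsilon)s^\upsilon\,\Delta\upsilon}$$ is increasing (respectively, decreasing) on $[\alpha,\beta]$.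
   Context: A time scale $\mathbb{T}$ is a nonempty closed subset of $\mathbb{R}$, and $[\alpha,\beta]_{\mathbb{T}}=[\alpha,\beta]\cap\mathbb{T}$. The Delta integral $\int_a^b f(\upsilon)\,\Delta\upsilon$ ($a\le b$ in $\mathbb{T}$) is the standard one, i.e. the integral of $f$ over $[a,b)\cap\mathbb{T}$ with respect to the Delta measure $\mu_\Delta$ on $\mathbb{T}$, determined by $\mu_\Delta([c,d)\cap\mathbb{T})=d-c$ for $c\le d$ in $\mathbb{T}$. "Increasing" and "decreasing" are meant in the non-strict sense.
   Formalization: The formal theorem adds the hypothesis α ≥ 0: for α < 0 the powers s^υ are in general undefined on [α,β], and where they are defined the claim can fail (time scale ℤ, α=−3, β=−1, T=1, φ=1, ψ=2). *)

theory Defs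
  imports "HOL-Analysis.Analysis"
begin

definition time_scale :: "real set \<Rightarrow> bool" where
  "time_scale \<T> \<longleftrightarrow> closed \<T> \<and> \<T> \<noteq> {}"

text \<open>The measure on the \<open>\<sigma>\<close>-algebra over \<open>\<T>\<close> generated by the sets
  \<open>[c, d) \<inter> \<T>\<close> that gives each of them the mass \<open>d - c\<close> (compare the library's
  \<^const>\<open>interval_measure\<close>). The two lemmas below show that such a measure exists and that the
  \<open>\<sigma>\<close>-algebra is the Borel one. If \<open>\<T>\<close> has a maximum, the mass of that one point is
  left undetermined; it does not enter integrals over \<open>[a, b) \<inter> \<T>\<close> with \<open>a, b \<in> \<T>\<close>.\<close>

definition delta_measure :: "real set \<Rightarrow> real measure" where
  "delta_measure \<T> =
     extend_measure \<T> {(c, d). c \<in> \<T> \<and> d \<in> \<T> \<and> c \<le> d}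
       (\<lambda>(c, d). {c..<d} \<inter> \<T>) (\<lambda>(c, d). ennreal (d - c))"

lemma space_delta_measure [simp]: "space (delta_measure \<T>) = \<T>"
  unfolding delta_measure_def by (rule space_extend_measure) auto

lemma sets_delta_measure_sigma:
  "sets (delta_measure \<T>) =
     sigma_sets \<T> ((\<lambda>(c, d). {c..<d} \<inter> \<T>) ` {(c, d). c \<in> \<T> \<and> d \<in> \<T> \<and> c \<le> d})"
  unfolding delta_measure_def by (rule sets_extend_measure) auto

lemma sets_delta_measure:
  assumes "time_scale \<T>"
  shows "sets (delta_measure \<T>) = sets (restrict_space borel \<T>)"
proof -
  let ?G = "(\<lambda>(c, d). {c..<d} \<inter> \<T>) ` {(c, d). c \<in> \<T> \<and> d \<in> \<T> \<and> c \<le> d}"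
  have cl: "closed \<T>" and ne: "\<T> \<noteq> {}"
    using assms by (auto simp: time_scale_def)
  have borel_eq: "sets (restrict_space borel \<T>) = sigma_sets \<T> ((\<inter>) \<T> ` range lessThan)"
  proof -
    have borel: "sigma_sets UNIV (range lessThan) = sets (borel :: real measure)"
      by (simp add: borel_Iio)
    have "\<T> \<in> sigma_sets UNIV (range lessThan)"
      unfolding borel using cl by (rule borel_closed)
    from sigma_sets_Int[OF this] show ?thesis
      by (simp add: sets_restrict_space borel)
  qed
  have lower: "\<T> \<inter> {..<d} \<in> sigma_sets \<T> ?G" if d: "d \<in> \<T>" for d
  proof -
    have "\<exists>c\<in>\<T>. c \<le> d \<and> (c \<le> - real n \<or> (\<forall>x\<in>\<T>. c \<le> x))" for n
    proof (cases "\<exists>c\<in>\<T>. c \<le> min d (- real n)")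
      case False
      then have bdd: "bdd_below \<T>"
        by (intro bdd_belowI[of _ "min d (- real n)"]) force
      then have "Inf \<T> \<in> \<T>"
        using closed_contains_Inf[OF ne] cl by blast
      then show ?thesis
        using bdd d by (intro bexI[of _ "Inf \<T>"]) (auto intro: cInf_lower)
    qed auto
    then obtain c where c: "\<And>n. c n \<in> \<T>" "\<And>n. c n \<le> d"
      "\<And>n. c n \<le> - real n \<or> (\<forall>x\<in>\<T>. c n \<le> x)"
      by metis
    have "\<T> \<inter> {..<d} = (\<Union>n. {c n..<d} \<inter> \<T>)"
    proof (intro equalityI subsetI)
      fix x assume x: "x \<in> \<T> \<inter> {..<d}"
      obtain n where "- x \<le> real n" using real_arch_simple by blast
      then have "c n \<le> x" using c(3)[of n] x by auto
      then show "x \<in> (\<Union>n. {c n..<d} \<inter> \<T>)" using x by auto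
    qed auto
    moreover have "{c n..<d} \<inter> \<T> \<in> sigma_sets \<T> ?G" for n
      by (rule sigma_sets.Basic) (use c d in auto)
    ultimately show ?thesis
      by (simp only: sigma_sets.Union)
  qed
  have "\<T> \<inter> {..<r} \<in> sigma_sets \<T> ?G" for r
  proof (cases "\<T> \<inter> {r..} = {}")
    case True
    then have "\<T> \<inter> {..<r} = \<T>" by force
    then show ?thesis by (simp add: sigma_sets_top)
  next
    case False
    let ?d = "Inf (\<T> \<inter> {r..})"
    have bdd: "bdd_below (\<T> \<inter> {r..})" by auto
    have mem: "?d \<in> \<T> \<inter> {r..}"
      by (rule closed_contains_Inf[OF False bdd]) (use cl in auto)
    have "\<T> \<inter> {..<r} = \<T> \<inter> {..<?d}"
    proof (intro equalityI subsetI)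
      fix x assume x: "x \<in> \<T> \<inter> {..<?d}"
      have "x < r"
      proof (rule ccontr)
        assume "\<not> x < r"
        then have "?d \<le> x" using x by (intro cInf_lower[OF _ bdd]) auto
        then show False using x by simp
      qed
      then show "x \<in> \<T> \<inter> {..<r}" using x by simp
    qed (use mem in auto)
    then show ?thesis using lower mem by simp
  qed
  then have "sigma_sets \<T> ((\<inter>) \<T> ` range lessThan) \<subseteq> sigma_sets \<T> ?G"
    by (intro sigma_sets_mono) auto
  moreover have "sigma_sets \<T> ?G \<subseteq> sets (restrict_space borel \<T>)"
  proof -
    have "{c..<d} \<inter> \<T> \<in> sets (restrict_space borel \<T>)" for c d
      unfolding sets_restrict_space by (rule image_eqI[of _ _ "{c..<d}"]) auto
    then have "?G \<subseteq> sets (restrict_space borel \<T>)"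
      by (intro image_subsetI) (simp only: split_def)
    from sets.sigma_sets_subset[OF this] show ?thesis
      by (simp only: space_restrict_space space_borel Int_UNIV_right)
  qed
  ultimately show ?thesis
    unfolding sets_delta_measure_sigma borel_eq by (rule subset_antisym[rotated])
qed

lemma emeasure_delta_measure:
  assumes \<T>: "time_scale \<T>" and cd: "c \<in> \<T>" "d \<in> \<T>" "c \<le> d"
  shows "emeasure (delta_measure \<T>) ({c..<d} \<inter> \<T>) = ennreal (d - c)"
proof -
  have cl: "closed \<T>" and ne: "\<T> \<noteq> {}"
    using \<T> by (auto simp: time_scale_def)
  define L where "L = {x. \<exists>t\<in>\<T>. t \<le> x}"
  define \<rho> where "\<rho> x = Sup (\<T> \<inter> {..x})" for x
  have \<rho>_mem: "\<rho> x \<in> \<T> \<inter> {..x}" if "x \<in> L" for x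
    unfolding \<rho>_def
    by (rule closed_contains_Sup) (use that cl in \<open>auto simp: L_def\<close>)
  have \<rho>_upper: "t \<le> \<rho> x" if "t \<in> \<T>" "t \<le> x" for t x
    unfolding \<rho>_def by (rule cSup_upper) (use that in auto)
  have L: "L \<in> sets borel"
  proof (cases "bdd_below \<T>")
    case True
    then have "Inf \<T> \<in> \<T>" using closed_contains_Inf[OF ne] cl by blast
    then have "L = {Inf \<T>..}"
      using True by (auto simp: L_def intro: cInf_lower order_trans)
    then show ?thesis by simp
  next
    case False
    have "x \<in> L" for x
    proof (rule ccontr)
      assume "x \<notin> L"
      then have "bdd_below \<T>" by (intro bdd_belowI[of _ x]) (force simp: L_def)
      then show False using False by simp
    qed
    then have "L = UNIV" by auto
    then show ?thesis by simp
  qed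
  have "mono_on L \<rho>"
  proof (rule mono_onI)
    fix x y assume "x \<in> L" "y \<in> L" "x \<le> y"
    then show "\<rho> x \<le> \<rho> y"
      using \<rho>_mem[of x] by (intro \<rho>_upper) auto
  qed
  then have "\<rho> \<in> borel_measurable (restrict_space borel L)"
    by (rule borel_measurable_mono_on_fnc)
  then have \<rho>_meas: "\<rho> \<in> restrict_space lborel L \<rightarrow>\<^sub>M restrict_space borel \<T>"
    using \<rho>_mem measurable_cong_sets[OF sets_restrict_space_cong[OF sets_lborel] refl]
    by (intro measurable_restrict_space2) (auto simp: space_restrict_space)
  let ?D = "distr (restrict_space lborel L) (restrict_space borel \<T>) \<rho>"
  have D: "emeasure ?D ({i..<j} \<inter> \<T>) = ennreal (j - i)"
    if "i \<in> \<T>" "j \<in> \<T>" "i \<le> j" for i j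
  proof -
    have "\<rho> -` ({i..<j} \<inter> \<T>) \<inter> L = {i..<j}"
    proof (intro equalityI subsetI)
      fix x assume x: "x \<in> \<rho> -` ({i..<j} \<inter> \<T>) \<inter> L"
      then have "\<not> j \<le> x" using \<rho>_upper[of j x] that by auto
      moreover have "i \<le> x" using x \<rho>_mem[of x] by auto
      ultimately show "x \<in> {i..<j}" by auto
    next
      fix x assume x: "x \<in> {i..<j}"
      then have "x \<in> L" using that by (auto simp: L_def)
      then show "x \<in> \<rho> -` ({i..<j} \<inter> \<T>) \<inter> L"
        using \<rho>_mem[of x] \<rho>_upper[of i x] x that by auto
    qed
    moreover have "{i..<j} \<inter> \<T> \<in> sets (restrict_space borel \<T>)"
      by (auto simp: sets_restrict_space)
    ultimately have "emeasure ?D ({i..<j} \<inter> \<T>) = emeasure (restrict_space lborel L) {i..<j}"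
      using \<rho>_meas by (simp add: emeasure_distr space_restrict_space)
    also have "\<dots> = emeasure lborel {i..<j}"
      by (rule emeasure_restrict_space) (use L that in \<open>auto simp: L_def\<close>)
    finally show ?thesis using that by simp
  qed
  have sets: "sets (delta_measure \<T>) = sets ?D"
    using sets_delta_measure[OF \<T>] by simp
  show ?thesis
  proof (rule emeasure_extend_measure_Pair[OF delta_measure_def, where \<mu>' = "emeasure ?D"])
    show "positive (sets (delta_measure \<T>)) (emeasure ?D)"
      unfolding sets by (rule emeasure_positive)
    show "countably_additive (sets (delta_measure \<T>)) (emeasure ?D)"
      unfolding sets by (rule emeasure_countably_additive)
  qed (use D cd in auto)
qed

text \<open>The completion is taken because the Delta measure is usually obtained as a Caratheodory
  extension, whose measurable sets include all subsets of null sets.\<close>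

definition delta_integrable :: "real set \<Rightarrow> real \<Rightarrow> real \<Rightarrow> (real \<Rightarrow> real) \<Rightarrow> bool" where
  "delta_integrable \<T> a b f \<longleftrightarrow> set_integrable (completion (delta_measure \<T>)) ({a..<b} \<inter> \<T>) f"

definition delta_integral :: "real set \<Rightarrow> real \<Rightarrow> real \<Rightarrow> (real \<Rightarrow> real) \<Rightarrow> real" where
  "delta_integral \<T> a b f = (LINT x:{a..<b} \<inter> \<T>|completion (delta_measure \<T>). f x)"

text \<open>The real power \<open>s\<^sup>\<upsilon>\<close> for \<open>s \<ge> 0\<close>, \<open>\<upsilon> \<ge> 0\<close> with the usual
  \<open>0\<^sup>0 = 1\<close>, where \<open>powr\<close> has the value \<open>0\<close>.\<close>

definition rpow :: "real \<Rightarrow> real \<Rightarrow> real" where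
  "rpow s \<upsilon> = (if \<upsilon> = 0 then 1 else s powr \<upsilon>)"

definition delta_quotient ::
  "real set \<Rightarrow> real \<Rightarrow> real \<Rightarrow> (real \<Rightarrow> real) \<Rightarrow> (real \<Rightarrow> real) \<Rightarrow> (real \<Rightarrow> real) \<Rightarrow> real \<Rightarrow> real" where
  "delta_quotient \<T> \<alpha> \<beta> T \<psi> \<phi> s =
     (T s + delta_integral \<T> \<alpha> \<beta> (\<lambda>\<upsilon>. \<psi> \<upsilon> * rpow s \<upsilon>)) /
     (T s + delta_integral \<T> \<alpha> \<beta> (\<lambda>\<upsilon>. \<phi> \<upsilon> * rpow s \<upsilon>))"

end

theory Submission
  imports Defs
begin

text \<open>Write \<open>\<Psi>\<close> and \<open>\<Phi>\<close> for the two integrals as functions of \<open>s\<close>. For \<open>s \<le> t\<close>, clearing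
  denominators in \<open>Q s \<le> Q t\<close> leaves the sum of two inequalities. The first,
  \<open>T t (\<Psi> s - \<Phi> s) \<le> T s (\<Psi> t - \<Phi> t)\<close>, holds because \<open>\<Psi> - \<Phi>\<close> is nonnegative and increasing
  while \<open>T\<close> decreases. The second, \<open>\<Psi> s \<Phi> t \<le> \<Psi> t \<Phi> s\<close>, is of Chebyshev type: both \<open>\<psi> / \<phi>\<close> and
  \<open>(t / s)\<^sup>\<upsilon>\<close> increase in \<open>\<upsilon>\<close>. The resulting inequality is symmetric enough that exchanging
  \<open>\<psi>\<close> and \<open>\<phi>\<close> settles the decreasing case.\<close>

text \<open>Integrating the hypothesis first in \<open>v\<close> and then in \<open>u\<close> gives twice the conclusion, because
  all terms are products; so neither Fubini nor \<open>\<sigma>\<close>-finiteness is needed.\<close>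

lemma set_integral_chebyshev:
  fixes f g a b :: "'a \<Rightarrow> real"
  assumes fa: "set_integrable M A (\<lambda>x. f x * a x)" and fb: "set_integrable M A (\<lambda>x. f x * b x)"
    and ga: "set_integrable M A (\<lambda>x. g x * a x)" and gb: "set_integrable M A (\<lambda>x. g x * b x)"
    and sync: "\<And>u v. u \<in> A \<Longrightarrow> v \<in> A \<Longrightarrow> 0 \<le> (g u * f v - f u * g v) * (a u * b v - a v * b u)"
  shows "(LINT x:A|M. f x * a x) * (LINT x:A|M. g x * b x)
       \<le> (LINT x:A|M. f x * b x) * (LINT x:A|M. g x * a x)"
proof -
  let ?fa = "LINT x:A|M. f x * a x" and ?fb = "LINT x:A|M. f x * b x"
  let ?ga = "LINT x:A|M. g x * a x" and ?gb = "LINT x:A|M. g x * b x"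
  note ints = fa fb ga gb
  have inner: "0 \<le> (g u * a u) * ?fb - (g u * b u) * ?fa - (f u * a u) * ?gb + (f u * b u) * ?ga"
    if u: "u \<in> A" for u
  proof -
    have "0 \<le> (LINT v:A|M. (g u * a u) * (f v * b v) - (g u * b u) * (f v * a v)
        - (f u * a u) * (g v * b v) + (f u * b u) * (g v * a v))"
      unfolding set_lebesgue_integral_def
      using sync[OF u] by (intro integral_nonneg_AE AE_I2) (auto simp: indicator_def algebra_simps)
    also have "\<dots> = (g u * a u) * ?fb - (g u * b u) * ?fa - (f u * a u) * ?gb + (f u * b u) * ?ga"
      using ints by (simp add: set_integral_add set_integral_diff)
    finally show ?thesis .
  qed
  have "0 \<le> (LINT u:A|M. (g u * a u) * ?fb - (g u * b u) * ?fa - (f u * a u) * ?gb + (f u * b u) * ?ga)"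
    \<comment> \<open>The instantiation limits the unfolding to the outer integral, so that the
      constants \<open>?fa\<close>, \<open>?fb\<close>, \<open>?ga\<close>, \<open>?gb\<close> keep
      the form they have in \<open>inner\<close>.\<close>
    unfolding set_lebesgue_integral_def[of M A "\<lambda>u. _ u - _ u - _ u + _ u"]
    using inner by (intro integral_nonneg_AE AE_I2) (auto simp: indicator_def)
  also have "\<dots> = ?ga * ?fb - ?gb * ?fa - ?fa * ?gb + ?fb * ?ga"
    using ints by (simp add: set_integral_add set_integral_diff)
  finally show ?thesis by (simp add: algebra_simps)
qed

lemma rpow_nonneg: "0 \<le> rpow s u"
  by (simp add: rpow_def)

lemma rpow_mono: "0 \<le> s \<Longrightarrow> s \<le> t \<Longrightarrow> 0 \<le> u \<Longrightarrow> rpow s u \<le> rpow t u"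
  by (simp add: rpow_def powr_mono2)

text \<open>With nonnegative exponents, a zero sum forces both to be zero. Opposite nonzero
  exponents at \<open>s = 0\<close> would give 1 on the left and 0 on the right.\<close>

lemma rpow_add: "0 \<le> u \<Longrightarrow> 0 \<le> v \<Longrightarrow> rpow s (u + v) = rpow s u * rpow s v"
  by (auto simp: rpow_def powr_add)

text \<open>Cancelling the common factor \<open>rpow s u * rpow t u\<close> leaves monotonicity in
  the base for the exponent \<open>v - u\<close>. The product form of "\<open>(t / s)\<close> to the
  power \<open>u\<close> increases in \<open>u\<close>" also covers \<open>s = 0\<close>.\<close>

lemma rpow_mult_le_rpow_mult:
  assumes "0 \<le> s" "s \<le> t" "0 \<le> u" "u \<le> v"
  shows "rpow s v * rpow t u \<le> rpow s u * rpow t v"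
proof -
  have split: "rpow x v = rpow x u * rpow x (v - u)" for x
    using rpow_add[of u "v - u" x] assms by simp
  show ?thesis
    using assms mult_left_mono[OF rpow_mono[of s t "v - u"], of "rpow s u * rpow t u"]
    by (simp add: split[of s] split[of t] rpow_nonneg ac_simps)
qed

text \<open>After expansion \<open>T s * T t\<close> cancels, and what remains is the sum of the two
  inequalities proved below. Comparing \<open>\<psi>\<close> and \<open>\<phi>\<close> by products
  rather than quotients lets the two be exchanged directly.\<close>

lemma set_integral_rpow_cross_le:
  fixes \<psi> \<phi> T :: "real \<Rightarrow> real"
  assumes st: "0 \<le> s" "s \<le> t"
    and A: "\<And>u. u \<in> A \<Longrightarrow> 0 \<le> u"
    and ints: "set_integrable M A (\<lambda>u. \<psi> u * rpow s u)" "set_integrable M A (\<lambda>u. \<psi> u * rpow t u)"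
      "set_integrable M A (\<lambda>u. \<phi> u * rpow s u)" "set_integrable M A (\<lambda>u. \<phi> u * rpow t u)"
    and T: "0 \<le> T t" "T t \<le> T s"
    and le: "\<And>u. u \<in> A \<Longrightarrow> \<phi> u \<le> \<psi> u"
    and ratio: "\<And>u v. u \<in> A \<Longrightarrow> v \<in> A \<Longrightarrow> u \<le> v \<Longrightarrow> \<psi> u * \<phi> v \<le> \<psi> v * \<phi> u"
  shows "(T s + (LINT u:A|M. \<psi> u * rpow s u)) * (T t + (LINT u:A|M. \<phi> u * rpow t u))
       \<le> (T t + (LINT u:A|M. \<psi> u * rpow t u)) * (T s + (LINT u:A|M. \<phi> u * rpow s u))"
proof -
  define P F where "P x = (LINT u:A|M. \<psi> u * rpow x u)" and "F x = (LINT u:A|M. \<phi> u * rpow x u)" for x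
  have "P s * F t \<le> P t * F s"
    unfolding P_def F_def
  proof (rule set_integral_chebyshev[OF ints])
    fix u v assume uv: "u \<in> A" "v \<in> A"
    \<comment> \<open>Both factors change sign together: they are nonnegative for
      \<open>u \<le> v\<close> and nonpositive for \<open>v \<le> u\<close>.\<close>
    show "0 \<le> (\<phi> u * \<psi> v - \<psi> u * \<phi> v) * (rpow s u * rpow t v - rpow s v * rpow t u)"
    proof (cases "u \<le> v")
      case True
      then show ?thesis
        using ratio[of u v] rpow_mult_le_rpow_mult[of s t u v] st A uv
        by (intro mult_nonneg_nonneg) (auto simp: mult.commute)
    next
      case False
      then show ?thesis
        using ratio[of v u] rpow_mult_le_rpow_mult[of s t v u] st A uv
        by (intro mult_nonpos_nonpos) (auto simp: mult.commute)
    qed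
  qed
  moreover have "T t * (P s - F s) \<le> T s * (P t - F t)"
  proof (rule mult_mono)
    \<comment> \<open>Under a single integral the sign of \<open>\<psi> u - \<phi> u\<close> is
      available pointwise from \<open>le\<close>; it yields both the growth from \<open>s\<close> to
      \<open>t\<close> and the nonnegativity at \<open>s\<close>.\<close>
    have diff: "P x - F x = (LINT u:A|M. (\<psi> u - \<phi> u) * rpow x u)"
      and int: "set_integrable M A (\<lambda>u. (\<psi> u - \<phi> u) * rpow x u)" if "x = s \<or> x = t" for x
      using that ints set_integral_diff[of M A "\<lambda>u. \<psi> u * rpow x u" "\<lambda>u. \<phi> u * rpow x u"]
      by (auto simp: P_def F_def left_diff_distrib)
    show "P s - F s \<le> P t - F t"
      unfolding diff[of s, simplified] diff[of t, simplified]
      by (rule set_integral_mono)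
        (use int st A le in \<open>auto intro!: mult_left_mono rpow_mono\<close>)
    show "0 \<le> P s - F s"
      unfolding diff[of s, simplified] set_lebesgue_integral_def using le
      by (intro integral_nonneg_AE AE_I2) (auto simp: indicator_def rpow_nonneg)
  qed (use T in auto)
  ultimately show ?thesis
    by (fold P_def F_def) (simp add: algebra_simps)
qed

theorem theorem3p2:
  fixes \<T> :: "real set" and \<alpha> \<beta> :: real and \<psi> \<phi> T :: "real \<Rightarrow> real"
  assumes "time_scale \<T>"
    and "\<alpha> \<in> \<T>" and "\<beta> \<in> \<T>" and "\<alpha> < \<beta>"
    and "0 \<le> \<alpha>"
    and "\<forall>\<upsilon>\<in>{\<alpha>..\<beta>} \<inter> \<T>. 0 < \<psi> \<upsilon>"
    and "\<forall>\<upsilon>\<in>{\<alpha>..\<beta>} \<inter> \<T>. 0 < \<phi> \<upsilon>"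
    and "\<forall>s\<in>{\<alpha>..\<beta>}. delta_integrable \<T> \<alpha> \<beta> (\<lambda>\<upsilon>. \<psi> \<upsilon> * rpow s \<upsilon>)"
    and "\<forall>s\<in>{\<alpha>..\<beta>}. delta_integrable \<T> \<alpha> \<beta> (\<lambda>\<upsilon>. \<phi> \<upsilon> * rpow s \<upsilon>)"
    and "\<forall>s\<in>{\<alpha>..\<beta>}. 0 < T s"
    and "T differentiable_on {\<alpha>..\<beta>}"
    and "antimono_on {\<alpha>..\<beta>} T"
  shows "(mono_on ({\<alpha>..\<beta>} \<inter> \<T>) (\<lambda>\<upsilon>. \<psi> \<upsilon> / \<phi> \<upsilon>) \<and> 1 \<le> \<psi> \<alpha> / \<phi> \<alpha> \<longrightarrow>
            mono_on {\<alpha>..\<beta>} (delta_quotient \<T> \<alpha> \<beta> T \<psi> \<phi>)) \<and>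
         (antimono_on ({\<alpha>..\<beta>} \<inter> \<T>) (\<lambda>\<upsilon>. \<psi> \<upsilon> / \<phi> \<upsilon>) \<and> \<psi> \<alpha> / \<phi> \<alpha> \<le> 1 \<longrightarrow>
            antimono_on {\<alpha>..\<beta>} (delta_quotient \<T> \<alpha> \<beta> T \<psi> \<phi>))"
proof -
  let ?A = "{\<alpha>..<\<beta>} \<inter> \<T>" and ?M = "completion (delta_measure \<T>)"
  note [simp] = assms(2)
  have pos: "0 < \<psi> u" "0 < \<phi> u" if "u \<in> ?A" for u
    using assms(6,7) that by auto
  have int: "set_integrable ?M ?A (\<lambda>u. \<psi> u * rpow s u)" "set_integrable ?M ?A (\<lambda>u. \<phi> u * rpow s u)"
    if "s \<in> {\<alpha>..\<beta>}" for s
    using assms(8,9) that by (auto simp: delta_integrable_def)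
  have T_le: "T t \<le> T s" if "s \<in> {\<alpha>..\<beta>}" "t \<in> {\<alpha>..\<beta>}" "s \<le> t" for s t
    using assms(12) that by (auto simp: monotone_on_def)
  \<comment> \<open>This holds for every real \<open>s\<close>: where the integrand is not
    integrable, the integral has the default value 0.\<close>
  have nonneg: "0 \<le> (LINT u:?A|?M. \<phi> u * rpow s u)" for s
    unfolding set_lebesgue_integral_def using pos
    by (intro integral_nonneg_AE AE_I2) (auto simp: indicator_def rpow_nonneg less_imp_le)
  have denom: "0 < T s + (LINT u:?A|?M. \<phi> u * rpow s u)" if "s \<in> {\<alpha>..\<beta>}" for s
    using nonneg[of s] assms(10) that by (auto intro: add_pos_nonneg)
  show ?thesis
  proof (intro conjI impI; elim conjE)
    assume mono: "mono_on ({\<alpha>..\<beta>} \<inter> \<T>) (\<lambda>u. \<psi> u / \<phi> u)" and 1: "1 \<le> \<psi> \<alpha> / \<phi> \<alpha>"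
    \<comment> \<open>\<open>\<alpha>\<close> is the least point of \<open>?A\<close>, so the bound
      on the ratio there propagates to all of \<open>?A\<close>.\<close>
    have le: "\<phi> u \<le> \<psi> u" if "u \<in> ?A" for u
      using order_trans[OF 1 mono_onD[OF mono, of \<alpha> u]] pos[OF that] that by (auto simp: le_divide_eq)
    have ratio: "\<psi> u * \<phi> v \<le> \<psi> v * \<phi> u" if "u \<in> ?A" "v \<in> ?A" "u \<le> v" for u v
      using mono_onD[OF mono, of u v] pos[of u] pos[of v] that by (auto simp: divide_le_eq le_divide_eq field_simps)
    show "mono_on {\<alpha>..\<beta>} (delta_quotient \<T> \<alpha> \<beta> T \<psi> \<phi>)"
    proof (rule monotone_onI)
      fix s t assume st: "s \<in> {\<alpha>..\<beta>}" "t \<in> {\<alpha>..\<beta>}" "s \<le> t"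
      have "(T s + (LINT u:?A|?M. \<psi> u * rpow s u)) * (T t + (LINT u:?A|?M. \<phi> u * rpow t u))
          \<le> (T t + (LINT u:?A|?M. \<psi> u * rpow t u)) * (T s + (LINT u:?A|?M. \<phi> u * rpow s u))"
        by (rule set_integral_rpow_cross_le)
          (use st assms(5,10) T_le int le ratio in \<open>auto simp: less_imp_le\<close>)
      then show "delta_quotient \<T> \<alpha> \<beta> T \<psi> \<phi> s \<le> delta_quotient \<T> \<alpha> \<beta> T \<psi> \<phi> t"
        using denom[OF st(1)] denom[OF st(2)]
        by (simp add: delta_quotient_def delta_integral_def divide_le_eq le_divide_eq mult.commute)
    qed
  next
    assume mono: "antimono_on ({\<alpha>..\<beta>} \<inter> \<T>) (\<lambda>u. \<psi> u / \<phi> u)" and 1: "\<psi> \<alpha> / \<phi> \<alpha> \<le> 1"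
    have le: "\<psi> u \<le> \<phi> u" if "u \<in> ?A" for u
      using order_trans[OF monotone_onD[OF mono, of \<alpha> u] 1] pos[OF that] that by (auto simp: divide_le_eq)
    have ratio: "\<phi> u * \<psi> v \<le> \<phi> v * \<psi> u" if "u \<in> ?A" "v \<in> ?A" "u \<le> v" for u v
      using monotone_onD[OF mono, of u v] pos[of u] pos[of v] that by (auto simp: divide_le_eq le_divide_eq field_simps)
    show "antimono_on {\<alpha>..\<beta>} (delta_quotient \<T> \<alpha> \<beta> T \<psi> \<phi>)"
    proof (rule monotone_onI)
      fix s t assume st: "s \<in> {\<alpha>..\<beta>}" "t \<in> {\<alpha>..\<beta>}" "s \<le> t"
      \<comment> \<open>Here \<open>\<phi> / \<psi>\<close> is increasing and at least 1, so the
        roles are exchanged. Dividing by the two positive \<open>\<phi>\<close>-denominators then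
        bounds the quotient at \<open>t\<close> by that at \<open>s\<close>.\<close>
      have "(T s + (LINT u:?A|?M. \<phi> u * rpow s u)) * (T t + (LINT u:?A|?M. \<psi> u * rpow t u))
          \<le> (T t + (LINT u:?A|?M. \<phi> u * rpow t u)) * (T s + (LINT u:?A|?M. \<psi> u * rpow s u))"
        by (rule set_integral_rpow_cross_le)
          (use st assms(5,10) T_le int le ratio in \<open>auto simp: less_imp_le\<close>)
      then show "delta_quotient \<T> \<alpha> \<beta> T \<psi> \<phi> s \<ge> delta_quotient \<T> \<alpha> \<beta> T \<psi> \<phi> t"
        using denom[OF st(1)] denom[OF st(2)]
        by (simp add: delta_quotient_def delta_integral_def divide_le_eq le_divide_eq mult.commute)
    qed
  qed
qed

end
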